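(* Let $n\ge1$, $x_0\in\mathbb{R}^d$, $\bar\Delta>0$. For $i\in\{1,\dots,n\}$ let $f_i:\mathbb{R}^d\to\mathbb{R}$ be in $\mathcal{C}^1$ and let $\{\widetilde f_{i,\Delta}\}_{\Delta\in(0,\bar\Delta]}$ be a class of (differentiable) models of $f_i$ that provides order-$N_i^f$ function accuracy of $f_i$ near $x_0$ and order-$N_i^g$ gradient accuracy of $f_i$ near $x_0$, where $N_i^f,N_i^g\ge0$. Put $F=f_1\cdots f_n$ and $\widetilde F_\Delta=\widetilde f_{1,\Delta}\cdots\widetilde f_{n,\Delta}$. Then $\{\widetilde F_\Delta\}_{(0,\bar\Delta]}$ provides order-$N_F^{fg}$ gradient accuracy of $F$ near $x_0$, where $N_F^{fg}=\min\{N_i^f,N_i^g:i=1,\dots,n\}$.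
   Context: $\|\cdot\|$ is the Euclidean norm and $B_\Delta(x_0)$ is the closed ball of radius $\Delta$ centered at $x_0$. A class of models of $f:\mathbb{R}^d\to\mathbb{R}$ is a family of functions $\widetilde f_\Delta:\mathbb{R}^d\to\mathbb{R}$ indexed by $\Delta\in(0,\bar\Delta]$; when gradients of models appear the models are understood to be differentiable. For real $N\ge0$, the class provides order-$N$ function (respectively gradient) accuracy of $f$ near $x_0$ if there is $\kappa\ge0$ such that $|f(x)-\widetilde f_\Delta(x)|\le\kappa\Delta^N$ (respectively $\|\nabla f(x)-\nabla\widetilde f_\Delta(x)\|\le\kappa\Delta^N$) for all $\Delta\in(0,\bar\Delta]$ and $x\in B_\Delta(x_0)$. *)

theory Defs
  imports "HOL-Analysis.Analysis"
begin

definition grad :: "('a::real_inner \<Rightarrow> real) \<Rightarrow> 'a \<Rightarrow> 'a" where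
  "grad f x = (THE D. GDERIV f x :> D)"

lemma grad_eqI:
  assumes "GDERIV f x :> D"
  shows "grad f x = D"
proof -
  have "D' = D" if "GDERIV f x :> D'" for D'
  proof -
    have "(\<lambda>h. h \<bullet> D') = (\<lambda>h. h \<bullet> D)"
      using that assms unfolding gderiv_def by (rule has_derivative_unique)
    then have "h \<bullet> D' = h \<bullet> D" for h
      by (rule fun_cong)
    then show ?thesis
      by (rule iffD1[OF vector_eq_ldot, OF allI])
  qed
  with assms show ?thesis
    unfolding grad_def by (rule the_equality)
qed

lemma gderiv_grad:
  fixes f :: "'a::euclidean_space \<Rightarrow> real"
  assumes "f differentiable (at x)"
  shows "GDERIV f x :> grad f x"
proof -
  obtain f' where f': "(f has_derivative f') (at x)"
    using assms unfolding differentiable_def by blast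
  then interpret linear f'
    by (rule has_derivative_linear)
  have "f' h = h \<bullet> adjoint f' 1" for h
    using adjoint_works[OF linear_axioms, of h 1] by simp
  then have "f' = (\<lambda>h. h \<bullet> adjoint f' 1)"
    by (rule ext)
  with f' have *: "GDERIV f x :> adjoint f' 1"
    unfolding gderiv_def by (rule subst[rotated])
  show ?thesis
    unfolding grad_eqI[OF *] by (rule *)
qed

definition C1 :: "('a::euclidean_space \<Rightarrow> real) \<Rightarrow> bool" where
  "C1 f \<longleftrightarrow> (\<forall>x. f differentiable (at x)) \<and> continuous_on UNIV (grad f)"

text \<open>
  A class of models is a function \<open>m\<close> taking the radius \<open>\<Delta>\<close> to the model \<open>m \<Delta>\<close>; only its values
  at \<open>\<Delta> \<in> {0<..\<Delta>max}\<close> matter.  The order \<open>N\<close> is real, hence \<open>powr\<close>, which is only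
  ever applied to \<open>\<Delta> > 0\<close> (so that \<open>\<Delta> powr 0 = 1\<close>).
\<close>

definition function_accuracy ::
  "('a::euclidean_space \<Rightarrow> real) \<Rightarrow> (real \<Rightarrow> 'a \<Rightarrow> real) \<Rightarrow> real \<Rightarrow> 'a \<Rightarrow> real \<Rightarrow> bool" where
  "function_accuracy f m \<Delta>max x0 N \<longleftrightarrow>
    (\<exists>\<kappa>\<ge>0. \<forall>\<Delta>\<in>{0<..\<Delta>max}. \<forall>x\<in>cball x0 \<Delta>. \<bar>f x - m \<Delta> x\<bar> \<le> \<kappa> * \<Delta> powr N)"

text \<open>
  Differentiability of the function and of its models is part of gradient accuracy, so that the
  bound never refers to the unspecified value of \<^const>\<open>grad\<close> at a point of non-differentiability.
\<close>

definition gradient_accuracy ::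
  "('a::euclidean_space \<Rightarrow> real) \<Rightarrow> (real \<Rightarrow> 'a \<Rightarrow> real) \<Rightarrow> real \<Rightarrow> 'a \<Rightarrow> real \<Rightarrow> bool" where
  "gradient_accuracy f m \<Delta>max x0 N \<longleftrightarrow>
    (\<forall>x. f differentiable (at x)) \<and>
    (\<forall>\<Delta>\<in>{0<..\<Delta>max}. \<forall>x. m \<Delta> differentiable (at x)) \<and>
    (\<exists>\<kappa>\<ge>0. \<forall>\<Delta>\<in>{0<..\<Delta>max}. \<forall>x\<in>cball x0 \<Delta>.
      norm (grad f x - grad (m \<Delta>) x) \<le> \<kappa> * \<Delta> powr N)"

end

theory Submission
  imports Defs
begin

text \<open>
  The gradient of a product is \<open>f \<nabla>g + g \<nabla>f\<close>, so everything reduces to one estimate: if \<open>v\<close>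
  approximates \<open>u\<close> and \<open>z\<close> approximates \<open>w\<close> to order \<open>N \<ge> 0\<close>, then \<open>v z\<close> approximates \<open>u w\<close> to
  order \<open>N\<close>, because \<open>u w - v z = (u - v) w + v (w - z)\<close>, where \<open>w\<close> is bounded by compactness and \<open>v\<close>
  since it stays within \<open>\<kappa> \<Delta>max powr N\<close> of the bounded function \<open>u\<close>.  All orders are first lowered
  to their minimum, and the number of factors is handled by induction.
\<close>

text \<open>The values lie in an arbitrary normed space so that one notion serves both real-valued
  functions and their vector-valued gradients.\<close>

definition approx_order ::
  "real \<Rightarrow> 'a::metric_space \<Rightarrow> real \<Rightarrow> ('a \<Rightarrow> 'b::real_normed_vector) \<Rightarrow> (real \<Rightarrow> 'a \<Rightarrow> 'b) \<Rightarrow> bool"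
  where
  "approx_order \<Delta>max x0 N u v \<longleftrightarrow>
    (\<exists>\<kappa>\<ge>0. \<forall>\<Delta>\<in>{0<..\<Delta>max}. \<forall>x\<in>cball x0 \<Delta>. norm (u x - v \<Delta> x) \<le> \<kappa> * \<Delta> powr N)"

lemma approx_orderI:
  assumes "\<kappa> \<ge> 0"
    and "\<And>\<Delta> x. 0 < \<Delta> \<Longrightarrow> \<Delta> \<le> \<Delta>max \<Longrightarrow> dist x0 x \<le> \<Delta> \<Longrightarrow> norm (u x - v \<Delta> x) \<le> \<kappa> * \<Delta> powr N"
  shows "approx_order \<Delta>max x0 N u v"
  using assms unfolding approx_order_def by auto

lemma approx_orderE:
  assumes "approx_order \<Delta>max x0 N u v"
  obtains \<kappa> where "\<kappa> \<ge> 0"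
    and "\<And>\<Delta> x. 0 < \<Delta> \<Longrightarrow> \<Delta> \<le> \<Delta>max \<Longrightarrow> dist x0 x \<le> \<Delta> \<Longrightarrow> norm (u x - v \<Delta> x) \<le> \<kappa> * \<Delta> powr N"
  using assms unfolding approx_order_def by auto

lemma approx_order_refl: "approx_order \<Delta>max x0 N u (\<lambda>_. u)"
  by (rule approx_orderI[of 0]) auto

text \<open>The models may be exchanged for radii in range only, because differentiability of the
  models, and hence the product rule for them, is available only there.\<close>

lemma approx_order_cong:
  assumes "approx_order \<Delta>max x0 N u v"
    and "\<And>x. u x = u' x"
    and "\<And>\<Delta> x. 0 < \<Delta> \<Longrightarrow> \<Delta> \<le> \<Delta>max \<Longrightarrow> v \<Delta> x = v' \<Delta> x"
  shows "approx_order \<Delta>max x0 N u' v'"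
  using assms unfolding approx_order_def by auto

text \<open>The surplus factor \<open>\<Delta> powr (N - M)\<close> has a nonnegative exponent, so
  it is largest at \<open>\<Delta>max\<close> and can be absorbed into the constant.\<close>

lemma approx_order_mono:
  assumes "approx_order \<Delta>max x0 N u v" and "M \<le> N"
  shows "approx_order \<Delta>max x0 M u v"
proof -
  obtain \<kappa> where \<kappa>: "\<kappa> \<ge> 0"
    "\<And>\<Delta> x. 0 < \<Delta> \<Longrightarrow> \<Delta> \<le> \<Delta>max \<Longrightarrow> dist x0 x \<le> \<Delta> \<Longrightarrow> norm (u x - v \<Delta> x) \<le> \<kappa> * \<Delta> powr N"
    using assms(1) by (rule approx_orderE) blast
  show ?thesis
  proof (rule approx_orderI)
    show "\<kappa> * \<Delta>max powr (N - M) \<ge> 0"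
      using \<kappa>(1) by simp
    fix \<Delta> x assume \<Delta>: "0 < \<Delta>" "\<Delta> \<le> \<Delta>max" and x: "dist x0 x \<le> \<Delta>"
    have "\<Delta> powr N = \<Delta> powr (N - M) * \<Delta> powr M"
      by (simp flip: powr_add)
    also have "\<dots> \<le> \<Delta>max powr (N - M) * \<Delta> powr M"
      using \<Delta> assms(2) by (intro mult_right_mono powr_mono2) auto
    finally have "\<kappa> * \<Delta> powr N \<le> \<kappa> * (\<Delta>max powr (N - M) * \<Delta> powr M)"
      using \<kappa>(1) by (rule mult_left_mono)
    then show "norm (u x - v \<Delta> x) \<le> \<kappa> * \<Delta>max powr (N - M) * \<Delta> powr M"
      using \<kappa>(2)[OF \<Delta> x] by (simp add: mult.assoc)
  qed
qed

lemma approx_order_add: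
  assumes "approx_order \<Delta>max x0 N u v" and "approx_order \<Delta>max x0 N w z"
  shows "approx_order \<Delta>max x0 N (\<lambda>x. u x + w x) (\<lambda>\<Delta> x. v \<Delta> x + z \<Delta> x)"
proof -
  obtain \<kappa> where \<kappa>: "\<kappa> \<ge> 0"
    "\<And>\<Delta> x. 0 < \<Delta> \<Longrightarrow> \<Delta> \<le> \<Delta>max \<Longrightarrow> dist x0 x \<le> \<Delta> \<Longrightarrow> norm (u x - v \<Delta> x) \<le> \<kappa> * \<Delta> powr N"
    using assms(1) by (rule approx_orderE) blast
  obtain \<mu> where \<mu>: "\<mu> \<ge> 0"
    "\<And>\<Delta> x. 0 < \<Delta> \<Longrightarrow> \<Delta> \<le> \<Delta>max \<Longrightarrow> dist x0 x \<le> \<Delta> \<Longrightarrow> norm (w x - z \<Delta> x) \<le> \<mu> * \<Delta> powr N"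
    using assms(2) by (rule approx_orderE) blast
  show ?thesis
  proof (rule approx_orderI)
    show "\<kappa> + \<mu> \<ge> 0"
      using \<kappa>(1) \<mu>(1) by simp
    fix \<Delta> x assume "0 < \<Delta>" "\<Delta> \<le> \<Delta>max" "dist x0 x \<le> \<Delta>"
    then show "norm (u x + w x - (v \<Delta> x + z \<Delta> x)) \<le> (\<kappa> + \<mu>) * \<Delta> powr N"
      unfolding distrib_right by (intro norm_diff_triangle_ineq[THEN order_trans] add_mono \<kappa> \<mu>)
  qed
qed

text \<open>Stated for \<open>*\<^sub>R\<close> to cover both products of functions, where it is
  multiplication of reals, and the terms \<open>f x *\<^sub>R grad g x\<close> of the product rule.
  Boundedness is assumed of the exact \<open>u\<close> and \<open>w\<close>; a bound on the models
  \<open>v\<close> follows from it.\<close>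

lemma approx_order_scaleR:
  assumes "approx_order \<Delta>max x0 N u v" and "approx_order \<Delta>max x0 N w z" and "N \<ge> 0"
    and "bounded (u ` cball x0 \<Delta>max)" and "bounded (w ` cball x0 \<Delta>max)"
  shows "approx_order \<Delta>max x0 N (\<lambda>x. u x *\<^sub>R w x) (\<lambda>\<Delta> x. v \<Delta> x *\<^sub>R z \<Delta> x)"
proof -
  obtain \<kappa> where \<kappa>: "\<kappa> \<ge> 0"
    "\<And>\<Delta> x. 0 < \<Delta> \<Longrightarrow> \<Delta> \<le> \<Delta>max \<Longrightarrow> dist x0 x \<le> \<Delta> \<Longrightarrow> norm (u x - v \<Delta> x) \<le> \<kappa> * \<Delta> powr N"
    using assms(1) by (rule approx_orderE) blast
  obtain \<mu> where \<mu>: "\<mu> \<ge> 0"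
    "\<And>\<Delta> x. 0 < \<Delta> \<Longrightarrow> \<Delta> \<le> \<Delta>max \<Longrightarrow> dist x0 x \<le> \<Delta> \<Longrightarrow> norm (w x - z \<Delta> x) \<le> \<mu> * \<Delta> powr N"
    using assms(2) by (rule approx_orderE) blast
  obtain A where A: "A > 0" "\<And>x. dist x0 x \<le> \<Delta>max \<Longrightarrow> \<bar>u x\<bar> \<le> A"
    using assms(4) by (auto simp: bounded_pos)
  obtain B where B: "B > 0" "\<And>x. dist x0 x \<le> \<Delta>max \<Longrightarrow> norm (w x) \<le> B"
    using assms(5) by (auto simp: bounded_pos)
  \<comment> \<open>A bound on \<open>v \<Delta>\<close> uniform in the radius: \<open>A\<close>
    bounds \<open>u\<close>, and since \<open>N \<ge> 0\<close> the error of \<open>v\<close> is at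
    most its value at \<open>\<Delta>max\<close>.\<close>
  define C where "C = A + \<kappa> * \<Delta>max powr N"
  have "C \<ge> 0"
    using A(1) \<kappa>(1) by (simp add: C_def)
  show ?thesis
  proof (rule approx_orderI)
    show "\<kappa> * B + C * \<mu> \<ge> 0"
      using \<kappa>(1) \<mu>(1) B(1) \<open>C \<ge> 0\<close> by simp
    fix \<Delta> x assume \<Delta>: "0 < \<Delta>" "\<Delta> \<le> \<Delta>max" and x: "dist x0 x \<le> \<Delta>"
    have "dist x0 x \<le> \<Delta>max"
      using \<Delta> x by simp
    note bounds = A(2)[OF this] B(2)[OF this]
    have "\<kappa> * \<Delta> powr N \<le> \<kappa> * \<Delta>max powr N"
      using \<Delta> \<kappa>(1) \<open>N \<ge> 0\<close> by (intro mult_left_mono powr_mono2) auto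
    then have v: "\<bar>v \<Delta> x\<bar> \<le> C"
      using \<kappa>(2)[OF \<Delta> x] bounds(1) unfolding C_def real_norm_def by linarith
    have "u x *\<^sub>R w x - v \<Delta> x *\<^sub>R z \<Delta> x = (u x - v \<Delta> x) *\<^sub>R w x + v \<Delta> x *\<^sub>R (w x - z \<Delta> x)"
      by (simp add: algebra_simps)
    also have "norm \<dots> \<le> norm (u x - v \<Delta> x) * norm (w x) + \<bar>v \<Delta> x\<bar> * norm (w x - z \<Delta> x)"
      using norm_triangle_ineq by (metis norm_scaleR real_norm_def)
    also have "\<dots> \<le> \<kappa> * \<Delta> powr N * B + C * (\<mu> * \<Delta> powr N)"
      using \<kappa>(1) \<open>C \<ge> 0\<close> by (intro add_mono mult_mono \<kappa>(2)[OF \<Delta> x] \<mu>(2)[OF \<Delta> x] bounds v) auto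
    also have "\<dots> = (\<kappa> * B + C * \<mu>) * \<Delta> powr N"
      by (simp add: algebra_simps)
    finally show "norm (u x *\<^sub>R w x - v \<Delta> x *\<^sub>R z \<Delta> x) \<le> (\<kappa> * B + C * \<mu>) * \<Delta> powr N" .
  qed
qed

lemma function_accuracy_iff:
  "function_accuracy f m \<Delta>max x0 N \<longleftrightarrow> approx_order \<Delta>max x0 N f m"
  by (simp add: function_accuracy_def approx_order_def)

lemma gradient_accuracy_iff:
  "gradient_accuracy f m \<Delta>max x0 N \<longleftrightarrow>
    (\<forall>x. f differentiable (at x)) \<and> (\<forall>\<Delta>\<in>{0<..\<Delta>max}. \<forall>x. m \<Delta> differentiable (at x)) \<and>
    approx_order \<Delta>max x0 N (grad f) (\<lambda>\<Delta>. grad (m \<Delta>))"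
  by (simp add: gradient_accuracy_def approx_order_def)

lemma grad_mult:
  fixes f g :: "'a::euclidean_space \<Rightarrow> real"
  assumes "f differentiable (at x)" and "g differentiable (at x)"
  shows "grad (\<lambda>x. f x * g x) x = f x *\<^sub>R grad g x + g x *\<^sub>R grad f x"
  using assms by (intro grad_eqI GDERIV_mult gderiv_grad)

lemma C1_imp_continuous_on: "C1 f \<Longrightarrow> continuous_on A f"
  unfolding C1_def
  by (intro differentiable_imp_continuous_on) (auto simp: differentiable_on_def differentiable_at_withinI)

lemma C1_mult:
  assumes "C1 f" and "C1 g"
  shows "C1 (\<lambda>x. f x * g x)"
proof -
  have "grad (\<lambda>x. f x * g x) = (\<lambda>x. f x *\<^sub>R grad g x + g x *\<^sub>R grad f x)"
    using assms by (auto simp: C1_def grad_mult)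
  moreover have "continuous_on UNIV (\<lambda>x. f x *\<^sub>R grad g x + g x *\<^sub>R grad f x)"
    using assms C1_imp_continuous_on[OF assms(1)] C1_imp_continuous_on[OF assms(2)]
    by (intro continuous_intros) (auto simp: C1_def)
  ultimately show ?thesis
    using assms by (auto simp: C1_def intro: differentiable_mult)
qed

lemma C1_const: "C1 (\<lambda>_::'a::euclidean_space. c)"
proof -
  have "grad (\<lambda>_::'a. c) = (\<lambda>_. 0)"
    by (intro ext grad_eqI GDERIV_const)
  then show ?thesis
    by (simp add: C1_def)
qed

text \<open>Both bounds are needed: in each term of the product rule, one factor is a function and
  the other a gradient.\<close>

lemma C1_bounded:
  fixes f :: "'a::euclidean_space \<Rightarrow> real"
  assumes "C1 f"
  shows "bounded (f ` cball x0 r)" and "bounded (grad f ` cball x0 r)"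
proof -
  show "bounded (f ` cball x0 r)"
    using assms
    by (intro compact_imp_bounded compact_continuous_image C1_imp_continuous_on compact_cball)
  have "continuous_on (cball x0 r) (grad f)"
    using assms unfolding C1_def by (blast intro: continuous_on_subset)
  then show "bounded (grad f ` cball x0 r)"
    by (intro compact_imp_bounded compact_continuous_image compact_cball)
qed

lemma function_accuracy_mult:
  assumes "C1 f" and "C1 g" and "N \<ge> 0"
    and "function_accuracy f m \<Delta>max x0 N" and "function_accuracy g k \<Delta>max x0 N"
  shows "function_accuracy (\<lambda>x. f x * g x) (\<lambda>\<Delta> x. m \<Delta> x * k \<Delta> x) \<Delta>max x0 N"
  using approx_order_scaleR[OF _ _ \<open>N \<ge> 0\<close> C1_bounded(1)[OF \<open>C1 f\<close>] C1_bounded(1)[OF \<open>C1 g\<close>]] assms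
  by (simp add: function_accuracy_iff)

text \<open>Each term of the product rule pairs the value of one factor with the gradient of the
  other, so function accuracy enters along with gradient accuracy.\<close>

lemma gradient_accuracy_mult:
  assumes "C1 f" and "C1 g" and "N \<ge> 0"
    and "function_accuracy f m \<Delta>max x0 N" and "function_accuracy g k \<Delta>max x0 N"
    and "gradient_accuracy f m \<Delta>max x0 N" and "gradient_accuracy g k \<Delta>max x0 N"
  shows "gradient_accuracy (\<lambda>x. f x * g x) (\<lambda>\<Delta> x. m \<Delta> x * k \<Delta> x) \<Delta>max x0 N"
proof -
  have "approx_order \<Delta>max x0 N (\<lambda>x. f x *\<^sub>R grad g x + g x *\<^sub>R grad f x)
      (\<lambda>\<Delta> x. m \<Delta> x *\<^sub>R grad (k \<Delta>) x + k \<Delta> x *\<^sub>R grad (m \<Delta>) x)"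
    using assms
    by (intro approx_order_add approx_order_scaleR C1_bounded)
      (auto simp: function_accuracy_iff gradient_accuracy_iff)
  then have "approx_order \<Delta>max x0 N (grad (\<lambda>x. f x * g x)) (\<lambda>\<Delta>. grad (\<lambda>x. m \<Delta> x * k \<Delta> x))"
    \<comment> \<open>The product rule is applied on both sides: to \<open>f\<close> and
      \<open>g\<close> everywhere, to \<open>m \<Delta>\<close> and \<open>k \<Delta>\<close> for
      each admissible radius.\<close>
    by (rule approx_order_cong) (use assms in \<open>auto simp: gradient_accuracy_iff grad_mult\<close>)
  then show ?thesis
    using assms by (auto simp: gradient_accuracy_iff intro: differentiable_mult)
qed

text \<open>The three claims go through one induction, since adding a factor to the gradient
  estimate uses smoothness and function accuracy of the product built so far.\<close>

lemma accuracy_prod: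
  fixes f :: "'i \<Rightarrow> 'a::euclidean_space \<Rightarrow> real"
  assumes "finite I" and "N \<ge> 0"
    and "\<And>i. i \<in> I \<Longrightarrow> C1 (f i)"
    and "\<And>i. i \<in> I \<Longrightarrow> function_accuracy (f i) (m i) \<Delta>max x0 N"
    and "\<And>i. i \<in> I \<Longrightarrow> gradient_accuracy (f i) (m i) \<Delta>max x0 N"
  shows "C1 (\<lambda>x. \<Prod>i\<in>I. f i x) \<and>
    function_accuracy (\<lambda>x. \<Prod>i\<in>I. f i x) (\<lambda>\<Delta> x. \<Prod>i\<in>I. m i \<Delta> x) \<Delta>max x0 N \<and>
    gradient_accuracy (\<lambda>x. \<Prod>i\<in>I. f i x) (\<lambda>\<Delta> x. \<Prod>i\<in>I. m i \<Delta> x) \<Delta>max x0 N"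
  using assms(1,3-)
proof (induction I rule: finite_induct)
  case empty
  \<comment> \<open>The empty product and its models are all the constant 1, so both errors
    vanish.\<close>
  then show ?case
    by (simp add: C1_const function_accuracy_iff gradient_accuracy_iff approx_order_refl)
next
  case (insert i I)
  then show ?case
    using \<open>N \<ge> 0\<close> by (simp add: C1_mult function_accuracy_mult gradient_accuracy_mult)
qed

theorem theorem18:
  fixes n :: nat
    and x0 :: "real ^ 'd"
    and \<Delta>max :: real
    and f :: "nat \<Rightarrow> real ^ 'd \<Rightarrow> real"
    and m :: "nat \<Rightarrow> real \<Rightarrow> real ^ 'd \<Rightarrow> real"
    and Nf Ng :: "nat \<Rightarrow> real"
  assumes "n \<ge> 1"
    and "\<Delta>max > 0"
    and "\<And>i. i \<in> {1..n} \<Longrightarrow> C1 (f i)"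
    and "\<And>i \<Delta> x. i \<in> {1..n} \<Longrightarrow> \<Delta> \<in> {0<..\<Delta>max} \<Longrightarrow> m i \<Delta> differentiable (at x)"
    and "\<And>i. i \<in> {1..n} \<Longrightarrow> Nf i \<ge> 0"
    and "\<And>i. i \<in> {1..n} \<Longrightarrow> Ng i \<ge> 0"
    and "\<And>i. i \<in> {1..n} \<Longrightarrow> function_accuracy (f i) (m i) \<Delta>max x0 (Nf i)"
    and "\<And>i. i \<in> {1..n} \<Longrightarrow> gradient_accuracy (f i) (m i) \<Delta>max x0 (Ng i)"
  shows "gradient_accuracy (\<lambda>x. \<Prod>i=1..n. f i x) (\<lambda>\<Delta> x. \<Prod>i=1..n. m i \<Delta> x) \<Delta>max x0
    (Min (Nf ` {1..n} \<union> Ng ` {1..n}))"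
proof -
  let ?N = "Min (Nf ` {1..n} \<union> Ng ` {1..n})"
  \<comment> \<open>Here \<open>n \<ge> 1\<close> makes the set of orders nonempty, so
    \<open>Min\<close> is a true minimum and inherits nonnegativity from its elements.\<close>
  have "?N \<ge> 0"
    using assms(1,5,6) by (subst Min_ge_iff) auto
  moreover have "function_accuracy (f i) (m i) \<Delta>max x0 ?N" if "i \<in> {1..n}" for i
  proof -
    have "?N \<le> Nf i"
      using that by (intro Min_le) auto
    then show ?thesis
      using assms(7)[OF that] unfolding function_accuracy_iff by (rule approx_order_mono[rotated])
  qed
  moreover have "gradient_accuracy (f i) (m i) \<Delta>max x0 ?N" if "i \<in> {1..n}" for i
  proof -
    have "?N \<le> Ng i"
      using that by (intro Min_le) auto
    then show ?thesis
      \<comment> \<open>The differentiability conjuncts do not involve the order and carry over;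
        only the error bound has to be lowered.\<close>
      using assms(8)[OF that] unfolding gradient_accuracy_iff by (blast intro: approx_order_mono)
  qed
  ultimately show ?thesis
    using accuracy_prod[of "{1..n}" ?N f m \<Delta>max x0] assms(3) by blast
qed

end
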